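(* Let $\alpha>0$, let $m$ be a positive integer with $m<1+\alpha$, and set $$r_{\alpha,m}=\left(\frac{\alpha+1-m}{\alpha+1+m}\right)^{\frac{1}{2m}}.$$ Then $(z_1,\dots,z_m)\in (B^* )^m\setminus\Theta_m$ is a critical point of $\Phi_m$ if and only if $z_1,\dots,z_m$ are the vertices of a regular $m$-gon (centered at the origin) satisfying $$|z_1|=\cdots=|z_m|=r_{\alpha,m}.$$ Moreover, for every integer $m'\ge 1+\alpha$, the function $\Phi_{m'}$ has no critical points in $(B^* )^{m'}\setminus\Theta_{m'}$.
   Context: $B=\{z\in\mathbb{C}:|z|<1\}$ is the unit disk ($\mathbb{R}^2$ is identified with $\mathbb{C}$), $B^*=B\setminus\{0\}$, and $\Theta_m=\{(z_1,\dots,z_m)\in B^m: z_j=z_l\text{ for some }j\ne l\}$. For fixed $\alpha>0$ and a positive integer $m$, the function $\Phi_m:(B^* )^m\setminus\Theta_m\to\mathbb{R}$ is $$\Phi_m(z_1,\dots,z_m)=2\alpha\sum_{j=1}^m\log|z_j|+2\sum_{j=1}^m\log(1-|z_j|^2)+2\sum_{\substack{j,k=1\\ j\ne k}}^m\log|1-z_j\overline{z_k}|-2\sum_{\substack{j,k=1\\ j\ne k}}^m\log|z_j-z_k|.$$ Critical points are taken with respect to all $2m$ real variables. "Vertices of a regular $m$-gon centered at the origin" means that, up to relabeling, $z_j=re^{i(\theta+2\pi(j-1)/m)}$ for some $r>0$, $\theta\in\mathbb{R}$ (a single point if $m=1$, an antipodal pair if $m=2$). *)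

theory Defs
  imports "HOL-Analysis.Analysis"
begin

text \<open>
  An \<open>m\<close>-tuple of complex numbers is an element of \<^typ>\<open>complex ^ 'm\<close>, where
  \<open>m = CARD('m)\<close>; this is a real Euclidean space of dimension \<open>2m\<close>.
\<close>

abbreviation unit_disk :: "complex set" where
  "unit_disk \<equiv> ball 0 1"

definition punctured_disk :: "complex set" where
  "punctured_disk = unit_disk - {0}"

definition punctured_polydisk :: "(complex ^ 'm) set" where
  "punctured_polydisk = {z. \<forall>j. z $ j \<in> punctured_disk}"

definition Theta :: "(complex ^ 'm) set" where
  "Theta = {z. (\<forall>j. z $ j \<in> unit_disk) \<and> (\<exists>j l. j \<noteq> l \<and> z $ j = z $ l)}"

text \<open>
  \<open>Phi \<alpha>\<close> is total, but only its values on \<open>punctured_polydisk - Theta\<close> are meaningful.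
  The double sums run over ordered pairs of distinct indices.
\<close>

definition Phi :: "real \<Rightarrow> complex ^ 'm \<Rightarrow> real" where
  "Phi \<alpha> z =
     2 * \<alpha> * (\<Sum>j\<in>UNIV. ln (norm (z $ j)))
     + 2 * (\<Sum>j\<in>UNIV. ln (1 - (norm (z $ j))\<^sup>2))
     + 2 * (\<Sum>(j, k) \<in> {(j, k). j \<noteq> k}. ln (norm (1 - z $ j * cnj (z $ k))))
     - 2 * (\<Sum>(j, k) \<in> {(j, k). j \<noteq> k}. ln (norm (z $ j - z $ k)))"

text \<open>
  Critical point of a real function on an open set \<open>U\<close>: the (real) total derivative
  exists and vanishes. For complex arguments this involves all real coordinates.
\<close>

definition critical_point ::
  "('a::euclidean_space \<Rightarrow> real) \<Rightarrow> 'a set \<Rightarrow> 'a \<Rightarrow> bool" where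
  "critical_point f U z \<longleftrightarrow> z \<in> U \<and> (f has_derivative (\<lambda>h. 0)) (at z)"

text \<open>The enumeration \<open>\<sigma>\<close> of the index type accounts for the relabeling.\<close>

definition regular_polygon_vertices :: "complex ^ 'm \<Rightarrow> bool" where
  "regular_polygon_vertices z \<longleftrightarrow>
     (\<exists>r \<theta> \<sigma>. r > 0 \<and> bij_betw \<sigma> {1..CARD('m)} UNIV \<and>
        (\<forall>j\<in>{1..CARD('m)}.
           z $ \<sigma> j = of_real r * cis (\<theta> + 2 * pi * (real j - 1) / real CARD('m))))"

definition critical_radius :: "real \<Rightarrow> nat \<Rightarrow> real" where
  "critical_radius \<alpha> m =
     ((\<alpha> + 1 - real m) / (\<alpha> + 1 + real m)) powr (1 / (2 * real m))"

end

theory Submission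
  imports Defs "HOL-Complex_Analysis.Complex_Analysis"
begin

text \<open>
  Let \<open>m\<close> be the number of points. Multiplying the complex gradient of \<open>\<Phi>\<close> by \<open>z\<^sub>j\<close> turns
  the critical point equations into the system
  \<open>\<alpha> = 2 (\<Sum>k. z\<^sub>j cnj z\<^sub>k / (1 - z\<^sub>j cnj z\<^sub>k)) + \<sigma>\<^sub>j\<close> with
  \<open>\<sigma>\<^sub>j = 2 (\<Sum>k\<noteq>j. z\<^sub>j / (z\<^sub>j - z\<^sub>k))\<close>
  (\<open>critical_point_iff_force_balance\<close>). The system is recast as an equation on the unit circle:
  put \<open>F w = \<Sum>k. (1 + cnj z\<^sub>k w) / (1 - cnj z\<^sub>k w)\<close>, which is holomorphic near the closed disk and
  has positive real part there, and let \<open>u\<close> be its real part on the circle. A partial fraction computation shows that a solution satisfies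
  \<open>Re (w F'(w)) = u\<^sup>2 - (\<alpha> + 1) u\<close> for \<open>\<bar>w\<bar> = 1\<close> (\<open>herglotz_boundary_equation\<close>). This is the
  equation of periodic travelling waves of the Benjamin-Ono equation, since the left side is
  \<open>\<bar>D\<bar> u\<close>.

  Following the idea of Amick and Toland, such an \<open>F\<close> solves an autonomous first-order equation: the
  function \<open>K = w F' - F\<^sup>2 / 2\<close> is constant (\<open>benjamin_ono_first_integral\<close>). Differentiating the
  boundary equation along the circle shows that \<open>Im K\<close> satisfies the same linear boundary
  condition \<open>\<partial>\<^sub>r f = (u - \<alpha> - 1) f\<close> as the positive harmonic function \<open>Re F\<close>. At a point \<open>\<zeta>\<close> of the
  circle where \<open>Im K / u\<close> is maximal, with value \<open>t\<close>, the harmonic function \<open>Im K - t Re F\<close>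
  has a boundary maximum with vanishing normal derivative, so a form of the Hopf lemma
  (\<open>boundary_max_critical_imp_constant\<close>) makes it constant, hence zero; evaluation at the centre
  gives \<open>t = 0\<close>, and \<open>K\<close> is constant.

  The partial fraction expansion of \<open>K\<close> has coefficients proportional to
  \<open>cnj (m - 1 - \<sigma>\<^sub>k)\<close>, so \<open>\<sigma>\<^sub>k = m - 1\<close> for all \<open>k\<close> (\<open>mutual_force_constant\<close>). In
  terms of \<open>P = \<Prod>k. (X - z\<^sub>k)\<close> this says that \<open>X P'' - (m - 1) P'\<close> vanishes at all \<open>z\<^sub>k\<close>; having
  degree below \<open>m\<close> it is zero, which forces \<open>P = X\<^sup>m - a\<close>. Thus the \<open>z\<^sub>k\<close> are the vertices of
  a regular polygon, and for those the first sum of the system can be evaluated, leaving the single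
  equation \<open>2 m \<bar>a\<bar>\<^sup>2 / (1 - \<bar>a\<bar>\<^sup>2) = \<alpha> + 1 - m\<close> (\<open>force_balance_iff_polygon\<close>). Its left side is
  positive, so there are no solutions when \<open>m \<ge> 1 + \<alpha>\<close>; otherwise it determines the radius.
\<close>

section \<open>A boundary point lemma for holomorphic functions on the disk\<close>

text \<open>
  A form of the Hopf boundary point lemma: if the real part of \<open>f\<close> is maximal over the unit circle at
  \<open>\<zeta>\<close> and \<open>f'(\<zeta>) = 0\<close>, then \<open>f\<close> is constant on the disk. Write \<open>f z - f \<zeta> = (z - \<zeta>)\<^sup>2 k z\<close> and
  \<open>g z = z \<zeta> k z\<close>. Since \<open>(z - \<zeta>)\<^sup>2 = - z \<zeta> \<bar>z - \<zeta>\<bar>\<^sup>2\<close> on the circle, \<open>g\<close> has nonnegative real part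
  there, whereas \<open>g 0 = 0\<close>; the maximum modulus principle for \<open>exp (- g)\<close> gives \<open>g = 0\<close>.
\<close>

lemma boundary_max_critical_imp_constant:
  fixes f :: "complex \<Rightarrow> complex"
  assumes "open S" "cball 0 1 \<subseteq> S" "f holomorphic_on S"
    and \<zeta>: "norm \<zeta> = 1" and crit: "deriv f \<zeta> = 0"
    and max: "\<And>z. norm z = 1 \<Longrightarrow> Re (f z) \<le> Re (f \<zeta>)"
    and z: "z \<in> ball 0 1"
  shows "f z = f \<zeta>"
proof -
  have \<zeta>S: "\<zeta> \<in> interior S"
    using assms(1,2) \<zeta> by (auto simp: interior_open)
  define k1 where "k1 = (\<lambda>z. if z = \<zeta> then deriv f \<zeta> else (f z - f \<zeta>) / (z - \<zeta>))"
  define k2 where "k2 = (\<lambda>z. if z = \<zeta> then deriv k1 \<zeta> else (k1 z - k1 \<zeta>) / (z - \<zeta>))"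
  have k1: "k1 holomorphic_on S"
    unfolding k1_def by (rule pole_lemma[OF assms(3) \<zeta>S])
  have k2: "k2 holomorphic_on S"
    unfolding k2_def by (rule pole_lemma[OF k1 \<zeta>S])
  have fac: "f z - f \<zeta> = (z - \<zeta>)\<^sup>2 * k2 z" for z
    by (auto simp: k2_def k1_def crit power2_eq_square)
  define g where "g = (\<lambda>z. z * \<zeta> * k2 z)"
  have g: "g holomorphic_on S"
    unfolding g_def by (intro holomorphic_intros k2)
  have g_circle: "f z - f \<zeta> = - of_real ((norm (z - \<zeta>))\<^sup>2) * g z" if "norm z = 1" for z
  proof -
    have 1: "z * cnj z = 1" "\<zeta> * cnj \<zeta> = 1"
      using that \<zeta> by (simp_all flip: complex_norm_square)
    have "of_real ((norm (z - \<zeta>))\<^sup>2) = (z - \<zeta>) * (cnj z - cnj \<zeta>)"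
      by (simp only: complex_norm_square complex_cnj_diff)
    then have "of_real ((norm (z - \<zeta>))\<^sup>2) * (z * \<zeta>) = (z - \<zeta>) * ((z * cnj z) * \<zeta> - z * (\<zeta> * cnj \<zeta>))"
      by (simp only:) (simp add: algebra_simps)
    also have "\<dots> = - (z - \<zeta>)\<^sup>2"
      unfolding 1 by (simp add: algebra_simps power2_eq_square)
    finally have "(z - \<zeta>)\<^sup>2 = - (of_real ((norm (z - \<zeta>))\<^sup>2) * (z * \<zeta>))"
      by (metis minus_minus)
    then show ?thesis
      unfolding fac g_def by (simp add: algebra_simps)
  qed
  have pos: "Re (g z) \<ge> 0" if "z \<in> sphere 0 1 - {\<zeta>}" for z
  proof -
    have "- ((norm (z - \<zeta>))\<^sup>2 * Re (g z)) = Re (f z) - Re (f \<zeta>)"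
      using arg_cong[OF g_circle[of z], of Re] that by simp
    then have "(norm (z - \<zeta>))\<^sup>2 * Re (g z) \<ge> 0"
      using max[of z] that by simp
    moreover have "(norm (z - \<zeta>))\<^sup>2 > 0"
      using that by simp
    ultimately show ?thesis
      by (simp add: zero_le_mult_iff)
  qed
  \<comment> \<open>The sign at \<open>\<zeta>\<close> itself follows by continuity, as \<open>\<zeta>\<close> is not isolated in the circle.\<close>
  have cl: "closure (sphere 0 1 - {\<zeta>}) = sphere (0::complex) 1"
  proof
    show "closure (sphere 0 1 - {\<zeta>}) \<subseteq> sphere 0 1"
      by (rule closure_minimal) auto
    have "\<zeta> islimpt sphere 0 1"
    proof (rule connected_imp_perfect)
      show "connected (sphere (0::complex) 1)"
        by (rule connected_sphere) simp
      show "\<zeta> \<in> sphere 0 1" using \<zeta> by simp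
      have "1 \<in> sphere (0::complex) 1" "-1 \<in> sphere (0::complex) 1" by auto
      moreover have "(1::complex) \<noteq> -1" by simp
      ultimately show "sphere (0::complex) 1 \<noteq> {a}" for a
        by (metis singletonD)
    qed
    then have "\<zeta> \<in> closure (sphere 0 1 - {\<zeta>})"
      by (simp add: islimpt_in_closure)
    then show "sphere 0 1 \<subseteq> closure (sphere 0 1 - {\<zeta>})"
      using closure_subset[of "sphere 0 1 - {\<zeta>}"] by blast
  qed
  have contg: "continuous_on S g"
    using g by (rule holomorphic_on_imp_continuous_on)
  have pos': "Re (g z) \<ge> 0" if "norm z = 1" for z
  proof (rule continuous_ge_on_closure[where S = "sphere 0 1 - {\<zeta>}" and f = "\<lambda>z. Re (g z)"])
    show "continuous_on (closure (sphere 0 1 - {\<zeta>})) (\<lambda>z. Re (g z))"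
      unfolding cl
      by (intro continuous_intros continuous_on_subset[OF contg])
         (use assms(2) sphere_cball in blast)
    show "z \<in> closure (sphere 0 1 - {\<zeta>})"
      unfolding cl using that by simp
  qed (use pos in auto)
  define e where "e = (\<lambda>z. exp (- g z))"
  have e: "e holomorphic_on S"
    unfolding e_def by (intro holomorphic_intros g)
  have eb: "e holomorphic_on ball 0 1"
    using e assms(2) by (meson ball_subset_cball holomorphic_on_subset order_trans)
  have gb: "g holomorphic_on ball 0 1"
    using g assms(2) by (meson ball_subset_cball holomorphic_on_subset order_trans)
  have fb: "f holomorphic_on ball 0 1"
    using assms(3) assms(2) by (meson ball_subset_cball holomorphic_on_subset order_trans)
  have e0: "e 0 = 1" by (simp add: e_def g_def)
  have le1: "norm (e z) \<le> 1" if "z \<in> ball 0 1" for z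
  proof (rule maximum_modulus_frontier[where S = "ball 0 1" and f = e])
    show "e holomorphic_on interior (ball 0 1)" using eb by simp
    show "continuous_on (closure (ball 0 1)) e"
      using holomorphic_on_imp_continuous_on[OF e] assms(2)
      by (auto intro: continuous_on_subset)
    show "norm (e w) \<le> 1" if "w \<in> frontier (ball 0 1)" for w
      using pos'[of w] that by (simp add: e_def)
    show "z \<in> ball 0 1" by (rule that)
  qed auto
  have "e constant_on ball 0 1"
    by (rule maximum_modulus_principle[OF eb, where U = "ball 0 1" and \<xi> = 0])
       (use le1 e0 in auto)
  then have e1: "e z = 1" if "z \<in> ball 0 1" for z
    using that e0 unfolding constant_on_def by (metis centre_in_ball zero_less_one)
  have dg: "(g has_field_derivative 0) (at z)" if "z \<in> ball 0 1" for z
  proof -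
    have "(g has_field_derivative deriv g z) (at z)"
      using gb that by (simp add: holomorphic_derivI)
    then have 1: "(e has_field_derivative exp (- g z) * (- deriv g z)) (at z)"
      unfolding e_def by (auto intro!: derivative_eq_intros)
    have 2: "(e has_field_derivative 0) (at z)"
      by (rule has_field_derivative_transform_within_open[where f = "\<lambda>_. 1" and S = "ball 0 1"])
         (use that e1 in auto)
    have "deriv g z = 0" using DERIV_unique[OF 1 2] by simp
    then show ?thesis using \<open>(g has_field_derivative deriv g z) (at z)\<close> by simp
  qed
  have g0: "g z = 0" if "z \<in> ball 0 1" for z
  proof -
    obtain c where "\<And>z. z \<in> ball 0 1 \<Longrightarrow> g z = c"
      using has_field_derivative_zero_constant[of "ball (0::complex) 1" g] dg
      by (metis convex_ball has_field_derivative_at_within)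
    from this[OF that] this[of 0] show ?thesis by (simp add: g_def)
  qed
  \<comment> \<open>The factor \<open>z\<close> in \<open>g\<close> excludes \<open>z = 0\<close> here; that point is recovered by continuity.\<close>
  have *: "f z = f \<zeta>" if "z \<in> ball 0 1 - {0}" for z
    using g0[of z] \<zeta> that fac[of z] by (auto simp: g_def)
  show ?thesis
  proof (rule continuous_constant_on_closure[where S = "ball 0 1 - {0}" and f = f])
    have "closure (ball 0 1 - {0::complex}) \<subseteq> cball 0 1"
      by (rule closure_minimal) auto
    with holomorphic_on_imp_continuous_on[OF assms(3)] assms(2)
    show "continuous_on (closure (ball 0 1 - {0})) f"
      by (meson continuous_on_subset order_trans)
    have "0 islimpt ball (0::complex) 1" by (simp add: islimpt_ball)
    then have "0 \<in> closure (ball 0 1 - {0::complex})"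
      by (simp add: islimpt_in_closure)
    then show "z \<in> closure (ball 0 1 - {0})"
      using z closure_subset[of "ball 0 1 - {0::complex}"] by (cases "z = 0") auto
  qed (rule *)
qed

section \<open>A first integral for Benjamin-Ono travelling waves\<close>

lemma has_real_derivative_Re_cis:
  assumes "(f has_field_derivative f') (at (cis t))"
  shows "((\<lambda>t. Re (f (cis t))) has_real_derivative - Im (cis t * f')) (at t)"
proof -
  have "((\<lambda>x. f (exp (\<i> * x))) has_field_derivative f' * (exp (\<i> * of_real t) * \<i>))
          (at (of_real t))"
    by (rule DERIV_chain2[where f = f])
       (use assms in \<open>auto simp: cis_conv_exp intro!: derivative_eq_intros\<close>)
  then have "((\<lambda>t. f (cis t)) has_vector_derivative f' * (cis t * \<i>)) (at t)"
    unfolding cis_conv_exp by (rule has_vector_derivative_real_field)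
  then have "((\<lambda>t. Re (f (cis t))) has_vector_derivative Re (f' * (cis t * \<i>))) (at t)"
    by (rule bounded_linear.has_vector_derivative[OF bounded_linear_Re])
  then show ?thesis
    by (simp add: has_real_derivative_iff_has_vector_derivative algebra_simps)
qed

lemma has_real_derivative_Im_cis:
  assumes "(f has_field_derivative f') (at (cis t))"
  shows "((\<lambda>t. Im (f (cis t))) has_real_derivative Re (cis t * f')) (at t)"
proof -
  have "((\<lambda>z. - \<i> * f z) has_field_derivative - \<i> * f') (at (cis t))"
    using assms by (rule DERIV_cmult)
  from has_real_derivative_Re_cis[OF this] show ?thesis
    by simp
qed

text \<open>
  The boundary values \<open>u = Re F\<close> satisfy the travelling wave equation \<open>\<bar>D\<bar> u = u\<^sup>2 - c u\<close>, because
  \<open>Re (z F'(z))\<close> is the radial derivative of \<open>Re F\<close>.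
\<close>

theorem benjamin_ono_first_integral:
  fixes F :: "complex \<Rightarrow> complex" and c :: real
  assumes S: "open S" "cball 0 1 \<subseteq> S" and F: "F holomorphic_on S"
    and pos: "\<And>z. norm z = 1 \<Longrightarrow> Re (F z) > 0"
    and bo: "\<And>z. norm z = 1 \<Longrightarrow> Re (z * deriv F z) = (Re (F z))\<^sup>2 - c * Re (F z)"
    and F0: "Im (F 0) = 0" "Re (F 0) \<noteq> 0"
    and w: "w \<in> ball 0 1"
  shows "w * deriv F w - (F w)\<^sup>2 / 2 = - (F 0)\<^sup>2 / 2"
proof -
  define K where "K = (\<lambda>z. z * deriv F z - (F z)\<^sup>2 / 2)"
  have dF: "deriv F holomorphic_on S"
    using F S(1) by (rule holomorphic_deriv)
  have K: "K holomorphic_on S"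
    unfolding K_def by (intro holomorphic_intros F dF) auto
  have FD: "(F has_field_derivative deriv F z) (at z)"
   and KD: "(K has_field_derivative deriv K z) (at z)" if "norm z = 1" for z
    using that F K S by (auto intro!: holomorphic_derivI[of _ S])
  have ImK: "Im (K z) = Im (z * deriv F z) - Re (F z) * Im (F z)" for z
    by (simp add: K_def power2_eq_square)
  \<comment> \<open>The boundary equation, rewritten so that it can be differentiated along the circle.\<close>
  have circle: "Re (K z) + c * Re (F z) = ((Re (F z))\<^sup>2 + (Im (F z))\<^sup>2) / 2"
    if "norm z = 1" for z
    using bo[OF that] by (simp add: K_def power2_eq_square field_simps)
  \<comment> \<open>The left side is the radial derivative of \<open>Im K\<close>; by hypothesis \<open>Re F\<close> satisfies the same
    linear boundary condition.\<close>
  have ImK': "Im (z * deriv K z) = (Re (F z) - c) * Im (K z)" if z: "norm z = 1" for z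
  proof -
    obtain t where t: "z = cis t"
      using z by (metis complex_norm_eq_1_exp cis_conv_exp)
    have "((\<lambda>t. Re (K (cis t)) + c * Re (F (cis t))) has_real_derivative
            - Im (z * deriv K z) + c * (- Im (z * deriv F z))) (at t)"
      unfolding t
      by (intro DERIV_add DERIV_cmult has_real_derivative_Re_cis FD KD) auto
    moreover have "((\<lambda>t. ((Re (F (cis t)))\<^sup>2 + (Im (F (cis t)))\<^sup>2) / 2) has_real_derivative
            - Re (F z) * Im (z * deriv F z) + Im (F z) * Re (z * deriv F z)) (at t)"
    proof -
      have sq: "((\<lambda>t. ((a t)\<^sup>2 + (b t)\<^sup>2) / 2) has_real_derivative a t * a' + b t * b') (at t)"
        if "(a has_real_derivative a') (at t)" "(b has_real_derivative b') (at t)" for a b a' b'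
        by (auto intro!: derivative_eq_intros that)
      have "(F has_field_derivative deriv F z) (at (cis t))"
        using FD z t by simp
      from sq[OF has_real_derivative_Re_cis[OF this] has_real_derivative_Im_cis[OF this]]
      show ?thesis
        by (simp add: t algebra_simps)
    qed
    moreover have "(\<lambda>t. Re (K (cis t)) + c * Re (F (cis t)))
        = (\<lambda>t. ((Re (F (cis t)))\<^sup>2 + (Im (F (cis t)))\<^sup>2) / 2)"
      using circle by auto
    ultimately have "- Im (z * deriv K z) + c * (- Im (z * deriv F z))
        = - Re (F z) * Im (z * deriv F z) + Im (F z) * Re (z * deriv F z)"
      by (simp only:) (rule DERIV_unique)
    then show ?thesis
      unfolding ImK bo[OF z] by (simp add: algebra_simps power2_eq_square)
  qed
  have contF: "continuous_on (sphere 0 1) F" and contK: "continuous_on (sphere 0 1) K"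
    using holomorphic_on_imp_continuous_on[OF F] holomorphic_on_imp_continuous_on[OF K]
      S(2) sphere_cball[of "0::complex" 1] by (meson continuous_on_subset order_trans)+
  have "continuous_on (sphere 0 1) (\<lambda>z. Im (K z) / Re (F z))"
    using pos by (intro continuous_intros contF contK) (force simp: less_le)
  then obtain \<zeta> where \<zeta>: "norm \<zeta> = 1"
    and max: "\<And>z. norm z = 1 \<Longrightarrow> Im (K z) / Re (F z) \<le> Im (K \<zeta>) / Re (F \<zeta>)"
    using continuous_attains_sup[of "sphere (0::complex) 1" "\<lambda>z. Im (K z) / Re (F z)"]
    by (auto simp: compact_sphere)
  define t where "t = Im (K \<zeta>) / Re (F \<zeta>)"
  define h where "h = (\<lambda>z. - \<i> * K z - of_real t * F z)"
  have Re_h: "Re (h z) = Im (K z) - t * Re (F z)" for z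
    by (simp add: h_def)
  have hS: "h holomorphic_on S"
    unfolding h_def by (intro holomorphic_intros F K)
  have hD: "(h has_field_derivative (- \<i> * deriv K z - of_real t * deriv F z)) (at z)"
    if "norm z = 1" for z
    unfolding h_def by (intro DERIV_diff DERIV_cmult FD KD that)
  have Re_h\<zeta>: "Re (h \<zeta>) = 0"
    using pos[OF \<zeta>] by (simp add: Re_h t_def)
  have hmax: "Re (h z) \<le> Re (h \<zeta>)" if "norm z = 1" for z
  proof -
    have "Im (K z) / Re (F z) \<le> t"
      using max[OF that] by (simp only: t_def)
    then have "Im (K z) \<le> t * Re (F z)"
      using pos[OF that] by (simp only: pos_divide_le_eq)
    then show ?thesis
      unfolding Re_h\<zeta> by (simp add: Re_h)
  qed
  have "deriv h \<zeta> = 0"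
  proof -
    define d where "d = deriv h \<zeta>"
    have d: "d = - \<i> * deriv K \<zeta> - of_real t * deriv F \<zeta>"
      unfolding d_def using hD[OF \<zeta>] by (rule DERIV_imp_deriv)
    have "Re (\<zeta> * d) = Im (\<zeta> * deriv K \<zeta>) - t * Re (\<zeta> * deriv F \<zeta>)"
      unfolding d by (simp add: algebra_simps)
    also have "\<dots> = (Re (F \<zeta>) - c) * Re (h \<zeta>)"
      unfolding ImK'[OF \<zeta>] bo[OF \<zeta>] Re_h by (simp add: algebra_simps power2_eq_square)
    \<comment> \<open>The radial derivative of \<open>Re h\<close> vanishes at \<open>\<zeta>\<close> by the boundary condition, the tangential one
      because \<open>\<zeta>\<close> is a maximum.\<close>
    finally have radial: "Re (\<zeta> * d) = 0"
      using Re_h\<zeta> by simp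
    obtain s where s: "\<zeta> = cis s"
      using \<zeta> by (metis complex_norm_eq_1_exp cis_conv_exp)
    have "((\<lambda>s. Re (h (cis s))) has_real_derivative - Im (\<zeta> * d)) (at s)"
      unfolding s
      by (rule has_real_derivative_Re_cis) (use hD[OF \<zeta>] d s in simp)
    then have "- Im (\<zeta> * d) = 0"
      by (rule DERIV_local_max[of _ _ _ 1]) (use hmax s in auto)
    with radial have "\<zeta> * d = 0"
      by (simp add: complex_eq_iff)
    then show ?thesis
      using \<zeta> by (auto simp: d_def)
  qed
  then have const: "h z = h \<zeta>" if "z \<in> ball 0 1" for z
    using boundary_max_critical_imp_constant[OF S hS \<zeta> _ hmax that] by simp
  have "Re (h 0) = - (t * Re (F 0))"
    using F0 by (simp add: Re_h K_def power2_eq_square)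
  then have "t = 0"
    using const[of 0] Re_h\<zeta> F0 by simp
  then have "K w = K 0"
    using const[OF w] const[of 0] by (simp add: h_def)
  then show ?thesis
    by (simp add: K_def)
qed

section \<open>Balanced configurations and their boundary equation\<close>

text \<open>
  The two parts of the gradient of \<open>\<Phi>\<close>, multiplied by \<open>z\<^sub>j\<close> and up to the constant factor \<open>- 2\<close>: \<open>mutual_force\<close> comes from the terms
  \<open>ln \<bar>z\<^sub>j - z\<^sub>k\<bar>\<close>, and \<open>image_force\<close> from the terms \<open>ln \<bar>1 - z\<^sub>j cnj z\<^sub>k\<bar>\<close>, where \<open>k = j\<close> accounts for
  \<open>ln (1 - \<bar>z\<^sub>j\<bar>\<^sup>2)\<close>. A critical point is a configuration in which they add up to \<open>\<alpha>\<close> at every \<open>j\<close>.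
\<close>

definition mutual_force :: "('m::finite \<Rightarrow> complex) \<Rightarrow> 'm \<Rightarrow> complex" where
  "mutual_force z j = (\<Sum>k\<in>UNIV - {j}. 2 * z j / (z j - z k))"

definition image_force :: "('m::finite \<Rightarrow> complex) \<Rightarrow> 'm \<Rightarrow> complex" where
  "image_force z j = (\<Sum>k\<in>UNIV. 2 * (z j * cnj (z k)) / (1 - z j * cnj (z k)))"

definition force_balance :: "real \<Rightarrow> ('m::finite \<Rightarrow> complex) \<Rightarrow> bool" where
  "force_balance \<alpha> z \<longleftrightarrow> (\<forall>j. image_force z j + mutual_force z j = of_real \<alpha>)"

text \<open>
  The diagonal term is a division by zero and hence equal to zero.
\<close>

lemma mutual_force_eq_sum_UNIV:
  "mutual_force z j = (\<Sum>k\<in>UNIV. 2 * z j / (z j - z k))"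
  unfolding mutual_force_def by (rule sum.mono_neutral_left) auto

text \<open>
  Simple fractions with distinct poles are linearly independent. After clearing denominators the sum
  becomes a polynomial \<open>p\<close> with infinitely many zeros, and \<open>p (1 / b\<^sub>k)\<close> is a nonzero multiple of \<open>c\<^sub>k\<close>.
\<close>

lemma simple_fractions_independent:
  fixes b c :: "'m::finite \<Rightarrow> complex"
  assumes b: "inj b" "\<And>k. b k \<noteq> 0" "\<And>k. norm (b k) < 1"
    and zero: "\<And>w. w \<in> ball 0 1 \<Longrightarrow> (\<Sum>k\<in>UNIV. c k / (1 - b k * w)) = 0"
  shows "c k = 0"
proof -
  define p where "p = (\<Sum>k\<in>UNIV. smult (c k) (\<Prod>j\<in>UNIV - {k}. [:1, - b j:]))"
  have "poly p w = 0" if w: "w \<in> ball 0 1" for w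
  proof -
    have nz: "1 - b k * w \<noteq> 0" for k
    proof
      assume "1 - b k * w = 0"
      then have "norm (b k) * norm w = 1" by (metis eq_iff_diff_eq_0 norm_mult norm_one)
      moreover have "norm (b k) * norm w \<le> norm (b k) * 1"
        using w by (intro mult_left_mono) auto
      ultimately show False using b(3)[of k] by simp
    qed
    have "poly p w = (\<Sum>k\<in>UNIV. c k * (\<Prod>j\<in>UNIV - {k}. 1 - b j * w))"
      by (simp add: p_def poly_sum poly_prod mult.commute)
    also have "\<dots> = (\<Sum>k\<in>UNIV. (\<Prod>j\<in>UNIV. 1 - b j * w) * (c k / (1 - b k * w)))"
    proof (rule sum.cong[OF refl])
      fix k :: 'm
      show "c k * (\<Prod>j\<in>UNIV - {k}. 1 - b j * w)
          = (\<Prod>j\<in>UNIV. 1 - b j * w) * (c k / (1 - b k * w))"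
        using nz[of k] by (simp add: prod.remove[of UNIV k])
    qed
    also have "\<dots> = 0"
      unfolding sum_distrib_left[symmetric] zero[OF w] by simp
    finally show ?thesis .
  qed
  then have "ball 0 1 \<subseteq> {w. poly p w = 0}" by blast
  moreover have "infinite (ball (0::complex) 1)"
    by (metis centre_in_ball empty_iff finite_imp_not_open open_ball zero_less_one)
  ultimately have "p = 0"
    using poly_roots_finite finite_subset by blast
  moreover have "poly p (1 / b k) = c k * (\<Prod>j\<in>UNIV - {k}. 1 - b j / b k)"
  proof -
    have "poly p (1 / b k) = (\<Sum>i\<in>UNIV. c i * (\<Prod>j\<in>UNIV - {i}. 1 - b j / b k))"
      by (simp add: p_def poly_sum poly_prod)
    also have "\<dots> = (\<Sum>i\<in>{k}. c i * (\<Prod>j\<in>UNIV - {i}. 1 - b j / b k))"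
      by (rule sum.mono_neutral_right) (use b(2) in \<open>auto intro!: prod_zero bexI[of _ k]\<close>)
    finally show ?thesis by simp
  qed
  moreover have "(\<Prod>j\<in>UNIV - {k}. 1 - b j / b k) \<noteq> 0"
    using b(2)[of k] injD[OF b(1)] by auto
  ultimately show ?thesis
    by simp
qed

lemma Re_inverse_one_minus_gt_half:
  fixes p :: complex
  assumes "norm p < 1"
  shows "Re (1 / (1 - p)) > 1 / 2"
proof -
  have "(norm p)\<^sup>2 < 1"
    using assms by (simp add: abs_square_less_1)
  then have n: "(Re p)\<^sup>2 + (Im p)\<^sup>2 < 1"
    by (simp add: cmod_power2)
  have "Re p < 1" using assms complex_Re_le_cmod[of p] by linarith
  then have "(1 - Re p)\<^sup>2 + (Im p)\<^sup>2 > 0"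
    by (simp add: add_pos_nonneg)
  then show ?thesis
    using n by (simp add: Re_divide power2_eq_square field_simps)
qed

text \<open>
  The families \<open>(z\<^sub>k)\<close> on which \<open>\<Phi>\<close> is considered: distinct points of the punctured unit disk.
\<close>

locale disk_configuration =
  fixes z :: "'m::finite \<Rightarrow> complex"
  assumes norm_less_1: "norm (z k) < 1"
    and nonzero: "z k \<noteq> 0"
    and inj: "inj z"
begin

text \<open>
  \<open>szego k\<close> is the Szego kernel at \<open>z\<^sub>k\<close>, and \<open>herglotz\<close> is the sum over \<open>k\<close> of
  \<open>(1 + cnj z\<^sub>k w) / (1 - cnj z\<^sub>k w) = 2 szego k w - 1\<close>. The real part of \<open>herglotz\<close> is the sum of the
  Poisson kernels at the points \<open>z\<^sub>k\<close> on the unit circle. Both are holomorphic off the reflections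
  \<open>1 / cnj z\<^sub>k\<close> of the points, collected in \<open>poles\<close>.
\<close>

definition szego :: "'m \<Rightarrow> complex \<Rightarrow> complex" where
  "szego k w = 1 / (1 - cnj (z k) * w)"

definition herglotz :: "complex \<Rightarrow> complex" where
  "herglotz w = 2 * (\<Sum>k\<in>UNIV. szego k w) - of_nat CARD('m)"

definition poles :: "complex set" where
  "poles = (\<lambda>k. 1 / cnj (z k)) ` UNIV"

lemma node_eq_iff: "z j = z k \<longleftrightarrow> j = k"
  using inj by (auto dest: injD)

lemma open_compl_poles: "open (- poles)"
  unfolding poles_def by (intro open_Compl finite_imp_closed) auto

lemma one_minus_neq_0:
  assumes "w \<notin> poles"
  shows "1 - cnj (z k) * w \<noteq> 0"
proof
  assume "1 - cnj (z k) * w = 0"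
  then have "w = 1 / cnj (z k)"
    using nonzero[of k] by (simp add: eq_divide_eq mult.commute)
  then show False using assms by (auto simp: poles_def)
qed

lemma cball_avoids_poles: "cball 0 1 \<subseteq> - poles"
proof -
  have "norm (1 / cnj (z k)) > 1" for k
    using norm_less_1[of k] nonzero[of k] by (simp add: norm_divide)
  then show ?thesis
    unfolding poles_def by (auto simp: not_le[symmetric])
qed

lemma not_pole: "norm w \<le> 1 \<Longrightarrow> w \<notin> poles"
  using cball_avoids_poles by (auto simp: subset_iff)

lemma szego_has_derivative:
  assumes "w \<notin> poles"
  shows "(szego k has_field_derivative cnj (z k) * (szego k w)\<^sup>2) (at w)"
  unfolding szego_def using one_minus_neq_0[OF assms, of k]
  by (auto intro!: derivative_eq_intros simp: power2_eq_square)

lemma herglotz_has_derivative: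
  assumes "w \<notin> poles"
  shows "(herglotz has_field_derivative 2 * (\<Sum>k\<in>UNIV. cnj (z k) * (szego k w)\<^sup>2)) (at w)"
proof -
  have "((\<lambda>w. 2 * (\<Sum>k\<in>UNIV. szego k w) - of_nat CARD('m)) has_field_derivative
      2 * (\<Sum>k\<in>UNIV. cnj (z k) * (szego k w)\<^sup>2) - 0) (at w)"
    by (intro DERIV_diff DERIV_cmult DERIV_sum DERIV_const szego_has_derivative assms)
  then show ?thesis
    by (simp add: herglotz_def[abs_def])
qed

lemma herglotz_holomorphic: "herglotz holomorphic_on - poles"
  using herglotz_has_derivative open_compl_poles
  by (auto simp: holomorphic_on_open)

lemma mult_deriv_herglotz:
  assumes "w \<notin> poles"
  shows "w * deriv herglotz w = 2 * ((\<Sum>k\<in>UNIV. (szego k w)\<^sup>2) - (\<Sum>k\<in>UNIV. szego k w))"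
proof -
  have "w * (cnj (z k) * (szego k w)\<^sup>2) = (szego k w)\<^sup>2 - szego k w" for k
  proof -
    have "szego k w * (1 - cnj (z k) * w) = 1"
      using one_minus_neq_0[OF assms, of k] by (simp add: szego_def)
    then show ?thesis
      by algebra
  qed
  then show ?thesis
    unfolding DERIV_imp_deriv[OF herglotz_has_derivative[OF assms]]
    by (simp add: mult.left_commute[of w 2] sum_distrib_left flip: sum_subtractf)
qed

text \<open>
  The products \<open>szego k w * szego j w\<close> with \<open>j \<noteq> k\<close> are split into partial fractions; the
  coefficients of \<open>szego k w\<close> add up to the conjugate of \<open>\<sigma>\<^sub>k = mutual_force z k\<close>.
\<close>

lemma szego_sum_square:
  assumes "w \<notin> poles"
  shows "(\<Sum>k\<in>UNIV. szego k w)\<^sup>2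
       = (\<Sum>k\<in>UNIV. (szego k w)\<^sup>2) + (\<Sum>k\<in>UNIV. cnj (mutual_force z k) * szego k w)"
proof -
  \<comment> \<open>On the diagonal, \<open>T k k = 0\<close> by division by zero.\<close>
  define T where "T k j = cnj (z k) / (cnj (z k) - cnj (z j)) * szego k w" for k j
  have T: "szego k w * szego j w = (if j = k then (szego k w)\<^sup>2 else 0) + (T k j + T j k)"
    for j k
  proof (cases "j = k")
    case False
    then have "cnj (z k) - cnj (z j) \<noteq> 0"
      by (simp add: node_eq_iff flip: complex_cnj_diff)
    moreover have "cnj (z j) - cnj (z k) = - (cnj (z k) - cnj (z j))" by simp
    ultimately have "T k j + T j k
        = (cnj (z k) * szego k w - cnj (z j) * szego j w) / (cnj (z k) - cnj (z j))"
      unfolding T_def by (simp only: divide_minus_right) (simp add: diff_divide_distrib)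
    also have "cnj (z k) * szego k w - cnj (z j) * szego j w
        = (cnj (z k) - cnj (z j)) * (szego k w * szego j w)"
      using one_minus_neq_0[OF assms, of k] one_minus_neq_0[OF assms, of j]
      by (simp add: szego_def divide_simps) (simp add: algebra_simps)
    finally show ?thesis
      using False \<open>cnj (z k) - cnj (z j) \<noteq> 0\<close> by simp
  qed (simp add: T_def power2_eq_square)
  have "(\<Sum>k\<in>UNIV. szego k w)\<^sup>2 = (\<Sum>k\<in>UNIV. \<Sum>j\<in>UNIV. szego k w * szego j w)"
    by (simp add: power2_eq_square sum_product)
  also have "\<dots> = (\<Sum>k\<in>UNIV. (szego k w)\<^sup>2)
      + ((\<Sum>k\<in>UNIV. \<Sum>j\<in>UNIV. T k j) + (\<Sum>k\<in>UNIV. \<Sum>j\<in>UNIV. T j k))"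
    unfolding T by (simp add: sum.distrib)
  also have "(\<Sum>k\<in>UNIV. \<Sum>j\<in>UNIV. T j k) = (\<Sum>k\<in>UNIV. \<Sum>j\<in>UNIV. T k j)"
    by (rule sum.swap)
  also have "(\<Sum>k\<in>UNIV. \<Sum>j\<in>UNIV. T k j) + (\<Sum>k\<in>UNIV. \<Sum>j\<in>UNIV. T k j)
      = (\<Sum>k\<in>UNIV. cnj (mutual_force z k) * szego k w)"
    unfolding mutual_force_eq_sum_UNIV T_def
    by (simp add: sum_distrib_right mult.assoc flip: sum.distrib)
  finally show ?thesis .
qed

lemma sum_mutual_force:
  "(\<Sum>j\<in>UNIV. mutual_force z j) = of_nat CARD('m) * (of_nat CARD('m) - 1)"
proof -
  define t where "t j k = z j / (z j - z k)" for j k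
  have t: "t j k + t k j = 1 - (if k = j then 1 else 0)" for j k
  proof (cases "k = j")
    case False
    then have "z j - z k \<noteq> 0" "z k - z j \<noteq> 0" by (simp_all add: node_eq_iff)
    then show ?thesis
      using False by (simp add: t_def divide_simps) (simp add: algebra_simps)
  qed (simp add: t_def)
  have "(\<Sum>j\<in>UNIV. mutual_force z j) = (\<Sum>j\<in>UNIV. \<Sum>k\<in>UNIV. t j k) + (\<Sum>j\<in>UNIV. \<Sum>k\<in>UNIV. t j k)"
    unfolding mutual_force_eq_sum_UNIV t_def by (simp flip: sum.distrib)
  also have "\<dots> = (\<Sum>j\<in>UNIV. \<Sum>k\<in>UNIV. t j k) + (\<Sum>j\<in>UNIV. \<Sum>k\<in>UNIV. t k j)"
    by (subst (2) sum.swap) (rule refl)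
  also have "\<dots> = (\<Sum>j\<in>(UNIV::'m set). \<Sum>k\<in>UNIV. 1 - (if k = j then 1 else 0))"
    unfolding sum.distrib[symmetric] t ..
  also have "\<dots> = of_nat CARD('m) * (of_nat CARD('m) - 1)"
    by (simp add: sum_subtractf)
  finally show ?thesis .
qed

lemma one_minus_gram_neq_0: "1 - z j * cnj (z k) \<noteq> 0"
proof
  assume "1 - z j * cnj (z k) = 0"
  then have "norm (z j) * norm (z k) = 1"
    by (metis eq_iff_diff_eq_0 norm_mult norm_one complex_mod_cnj)
  moreover have "norm (z j) * norm (z k) \<le> norm (z j) * 1"
    using norm_less_1[of k] by (intro mult_left_mono) auto
  ultimately show False using norm_less_1[of j] by simp
qed

lemma image_force_eq:
  "image_force z j = 2 * (\<Sum>k\<in>UNIV. 1 / (1 - z j * cnj (z k))) - 2 * of_nat CARD('m)"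
proof -
  have "2 * (z j * cnj (z k)) / (1 - z j * cnj (z k)) = 2 * (1 / (1 - z j * cnj (z k))) - 2" for k
    using one_minus_gram_neq_0[of j k] by (simp add: field_simps)
  then show ?thesis
    by (simp add: image_force_def sum_subtractf sum_distrib_left)
qed

text \<open>
  The counterpart for the products \<open>szego k w * cnj (szego j w)\<close>, whose partial fraction expansion
  on the circle uses \<open>cnj w = 1 / w\<close>.
\<close>

lemma szego_sum_abs_square:
  assumes w: "norm w = 1"
  defines "\<mu> \<equiv> \<lambda>j. \<Sum>k\<in>UNIV. 1 / (1 - z j * cnj (z k))"
  defines "g \<equiv> \<Sum>k\<in>UNIV. cnj (\<mu> k) * szego k w"
  shows "(\<Sum>k\<in>UNIV. szego k w) * cnj (\<Sum>k\<in>UNIV. szego k w) = g + cnj g - (\<Sum>j\<in>UNIV. \<mu> j)"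
proof -
  define M where "M j k = 1 / (1 - z j * cnj (z k))" for j k
  have wp: "w \<notin> poles" using w by (simp add: not_pole)
  have ww: "w * cnj w = 1" using w by (simp flip: complex_norm_square)
  have prod: "szego k w * cnj (szego j w) = M j k * szego k w + M j k * cnj (szego j w) - M j k"
    for j k
  proof -
    have "1 - z j * cnj w \<noteq> 0"
      using one_minus_neq_0[OF wp, of j] by (metis complex_cnj_cnj complex_cnj_diff
        complex_cnj_mult complex_cnj_one complex_cnj_zero)
    moreover have "(1 - z j * cnj (z k))
        = (1 - z j * cnj w) + (1 - cnj (z k) * w) - (1 - cnj (z k) * w) * (1 - z j * cnj w)"
      using ww by (simp add: algebra_simps)
    ultimately show ?thesis
      using one_minus_neq_0[OF wp, of k] one_minus_gram_neq_0[of j k]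
      unfolding szego_def M_def by (simp add: divide_simps)
  qed
  have "(\<Sum>k\<in>UNIV. szego k w) * cnj (\<Sum>k\<in>UNIV. szego k w)
      = (\<Sum>k\<in>UNIV. \<Sum>j\<in>UNIV. szego k w * cnj (szego j w))"
    by (simp add: sum_product)
  also have "\<dots> = (\<Sum>k\<in>UNIV. \<Sum>j\<in>UNIV. M j k * szego k w)
      + (\<Sum>k\<in>UNIV. \<Sum>j\<in>UNIV. M j k * cnj (szego j w)) - (\<Sum>k\<in>UNIV. \<Sum>j\<in>UNIV. M j k)"
    unfolding prod by (simp add: sum.distrib sum_subtractf)
  also have "(\<Sum>k\<in>UNIV. \<Sum>j\<in>UNIV. M j k * szego k w) = g"
    by (simp add: g_def \<mu>_def M_def sum_distrib_right sum_distrib_left mult.commute)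
  also have "(\<Sum>k\<in>UNIV. \<Sum>j\<in>UNIV. M j k * cnj (szego j w)) = cnj g"
    by (subst sum.swap) (simp add: g_def \<mu>_def M_def sum_distrib_right)
  also have "(\<Sum>k\<in>UNIV. \<Sum>j\<in>UNIV. M j k) = (\<Sum>j\<in>UNIV. \<mu> j)"
    by (subst sum.swap) (simp add: \<mu>_def M_def)
  finally show ?thesis .
qed

text \<open>
  The force balance determines the coefficients \<open>\<mu>\<^sub>j\<close> of \<open>\<bar>S\<^sub>1\<bar>\<^sup>2\<close> in terms of the coefficients \<open>\<sigma>\<^sub>j\<close> of
  \<open>S\<^sub>1\<^sup>2\<close>, where \<open>S\<^sub>1\<close> is the sum of the Szego kernels. In \<open>2 (Re S\<^sub>1)\<^sup>2 = \<bar>S\<^sub>1\<bar>\<^sup>2 + Re (S\<^sub>1\<^sup>2)\<close> the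
  \<open>\<sigma>\<^sub>j\<close> then cancel.
\<close>

lemma herglotz_boundary_equation:
  assumes bal: "force_balance \<alpha> z" and w: "norm w = 1"
  shows "Re (w * deriv herglotz w) = (Re (herglotz w))\<^sup>2 - (\<alpha> + 1) * Re (herglotz w)"
proof -
  define m :: real where "m = real CARD('m)"
  define S1 where "S1 = (\<Sum>k\<in>UNIV. szego k w)"
  define S2 where "S2 = (\<Sum>k\<in>UNIV. (szego k w)\<^sup>2)"
  define A where "A = (\<Sum>k\<in>UNIV. cnj (mutual_force z k) * szego k w)"
  define \<mu> where "\<mu> j = (\<Sum>k\<in>UNIV. 1 / (1 - z j * cnj (z k)))" for j
  define g where "g = (\<Sum>k\<in>UNIV. cnj (\<mu> k) * szego k w)"
  have wp: "w \<notin> poles" using w by (simp add: not_pole)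
  have \<mu>: "2 * \<mu> j = of_real (\<alpha> + 2 * m) - mutual_force z j" for j
    using bal unfolding force_balance_def image_force_eq \<mu>_def m_def
    by (auto simp: algebra_simps dest!: spec[of _ j])
  have "2 * g = (\<Sum>k\<in>UNIV. cnj (2 * \<mu> k) * szego k w)"
    by (simp add: g_def sum_distrib_left mult.assoc)
  also have "\<dots> = of_real (\<alpha> + 2 * m) * S1 - A"
    unfolding \<mu> S1_def A_def
    by (simp add: sum_distrib_left left_diff_distrib mult.assoc sum_subtractf)
  finally have "Re (2 * g) = Re (of_real (\<alpha> + 2 * m) * S1 - A)"
    by simp
  then have 1: "2 * Re g = (\<alpha> + 2 * m) * Re S1 - Re A"
    by simp
  have "2 * (\<Sum>j\<in>UNIV. \<mu> j) = (\<Sum>j\<in>UNIV. of_real (\<alpha> + 2 * m) - mutual_force z j)"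
    unfolding sum_distrib_left \<mu> ..
  also have "\<dots> = of_real (m * (\<alpha> + 2 * m) - m * (m - 1))"
    by (simp add: sum_subtractf sum_mutual_force m_def)
  finally have "Re (2 * (\<Sum>j\<in>UNIV. \<mu> j)) = m * (\<alpha> + 2 * m) - m * (m - 1)"
    by (simp only: Re_complex_of_real)
  then have 2: "2 * Re (\<Sum>j\<in>UNIV. \<mu> j) = m * (\<alpha> + 2 * m) - m * (m - 1)"
    by simp
  have "Re (S1\<^sup>2) = Re (S2 + A)"
    unfolding S1_def S2_def A_def szego_sum_square[OF wp] ..
  then have 3: "(Re S1)\<^sup>2 - (Im S1)\<^sup>2 = Re S2 + Re A"
    by (simp add: power2_eq_square)
  have "Re (S1 * cnj S1) = Re (g + cnj g - (\<Sum>j\<in>UNIV. \<mu> j))"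
    using szego_sum_abs_square[OF w] unfolding S1_def g_def \<mu>_def by simp
  then have 4: "(Re S1)\<^sup>2 + (Im S1)\<^sup>2 = 2 * Re g - Re (\<Sum>j\<in>UNIV. \<mu> j)"
    by (simp only: complex_mult_cnj Re_complex_of_real minus_complex.sel plus_complex.sel
        complex_cnj mult_2 cnj.sel)
  have u: "Re (herglotz w) = 2 * Re S1 - m"
    by (simp add: herglotz_def S1_def m_def)
  have "Re (w * deriv herglotz w) = 2 * (Re S2 - Re S1)"
    unfolding mult_deriv_herglotz[OF wp] S1_def S2_def by simp
  moreover have "4 * (Re S1)\<^sup>2
      = 2 * ((\<alpha> + 2 * m) * Re S1 - Re A) - (m * (\<alpha> + 2 * m) - m * (m - 1)) + 2 * (Re S2 + Re A)"
  proof -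
    have "4 * (Re S1)\<^sup>2 = 2 * (2 * Re g) - 2 * Re (\<Sum>j\<in>UNIV. \<mu> j) + 2 * (Re S2 + Re A)"
      using 3 4 by (simp only: flip: 3) (simp add: algebra_simps)
    then show ?thesis
      unfolding 1 2 .
  qed
  ultimately show ?thesis
    unfolding u by (simp add: algebra_simps power2_eq_square)
qed

lemma Re_herglotz_pos:
  assumes "norm w = 1"
  shows "Re (herglotz w) > 0"
proof -
  have "(\<Sum>k\<in>(UNIV::'m set). 1 / 2) < (\<Sum>k\<in>UNIV. Re (szego k w))"
    unfolding szego_def
    by (intro sum_strict_mono Re_inverse_one_minus_gt_half)
       (use norm_less_1 assms in \<open>auto simp: norm_mult\<close>)
  then show ?thesis
    by (simp add: herglotz_def)
qed

lemma herglotz_0: "herglotz 0 = of_nat CARD('m)"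
  by (simp add: herglotz_def szego_def)

text \<open>
  By \<open>szego_sum_square\<close>, the constancy of the first integral is a linear relation between the Szego
  kernels.
\<close>

theorem mutual_force_constant:
  assumes "force_balance \<alpha> z"
  shows "mutual_force z k = of_nat CARD('m) - 1"
proof -
  let ?m = "of_nat CARD('m) :: complex"
  have "(\<Sum>k\<in>UNIV. (cnj (mutual_force z k) - (?m - 1)) / (1 - cnj (z k) * w)) = 0"
    if w: "w \<in> ball 0 1" for w
  proof -
    define S1 where "S1 = (\<Sum>k\<in>UNIV. szego k w)"
    define S2 where "S2 = (\<Sum>k\<in>UNIV. (szego k w)\<^sup>2)"
    define A where "A = (\<Sum>k\<in>UNIV. cnj (mutual_force z k) * szego k w)"
    have wp: "w \<notin> poles" using w by (simp add: not_pole)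
    have "w * deriv herglotz w - (herglotz w)\<^sup>2 / 2 = - (herglotz 0)\<^sup>2 / 2"
      using benjamin_ono_first_integral[OF open_compl_poles cball_avoids_poles
          herglotz_holomorphic Re_herglotz_pos herglotz_boundary_equation[OF assms] _ _ w]
      by (simp add: herglotz_0)
    then have "2 * (S2 - S1) - (2 * S1 - ?m)\<^sup>2 / 2 = - ?m\<^sup>2 / 2"
      unfolding mult_deriv_herglotz[OF wp] herglotz_0 by (simp add: herglotz_def S1_def S2_def)
    moreover have "S1\<^sup>2 = S2 + A"
      unfolding S1_def S2_def A_def by (rule szego_sum_square[OF wp])
    ultimately have "A - (?m - 1) * S1 = 0"
      by (simp add: power2_eq_square field_simps) algebra
    then show ?thesis
      unfolding A_def S1_def szego_def
      by (simp add: sum_distrib_left diff_divide_distrib flip: sum_subtractf)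
  qed
  then have "cnj (mutual_force z k) - (?m - 1) = 0"
    by (rule simple_fractions_independent[of "\<lambda>k. cnj (z k)", rotated 3])
       (simp_all add: inj_def node_eq_iff nonzero norm_less_1)
  then have "cnj (cnj (mutual_force z k)) = cnj (?m - 1)" by simp
  then show ?thesis by simp
qed

end

section \<open>Regular polygons\<close>

text \<open>
  The logarithmic derivative of a product of linear factors.
\<close>

lemma poly_pderiv_prod_linear:
  fixes z :: "'a \<Rightarrow> 'b::field_char_0"
  assumes "finite A" "\<And>a. a \<in> A \<Longrightarrow> w \<noteq> z a"
  shows "poly (pderiv (\<Prod>a\<in>A. [:- z a, 1:])) w
       = poly (\<Prod>a\<in>A. [:- z a, 1:]) w * (\<Sum>a\<in>A. 1 / (w - z a))"
proof -
  have "poly (\<Prod>b\<in>A - {a}. [:- z b, 1:]) w = poly (\<Prod>b\<in>A. [:- z b, 1:]) w * (1 / (w - z a))"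
    if "a \<in> A" for a
  proof -
    have "w - z a \<noteq> 0" using assms(2)[OF that] by simp
    moreover have "(\<Prod>b\<in>A. w - z b) = (w - z a) * (\<Prod>b\<in>A - {a}. w - z b)"
      using assms(1) that by (rule prod.remove)
    ultimately show ?thesis
      by (simp add: poly_prod)
  qed
  then show ?thesis
    by (simp add: pderiv_prod pderiv_pCons poly_sum sum_distrib_left)
qed

lemma pderiv_linear_mult: "pderiv ([:a, 1:] * q) = [:a, 1:] * pderiv q + q"
proof -
  have "pderiv [:a, 1:] = 1" by (simp add: pderiv_pCons)
  then show ?thesis by (simp only: pderiv_mult mult_1_right)
qed

context disk_configuration
begin

text \<open>
  The monic polynomial \<open>P\<close> with simple zeros at the points \<open>z\<^sub>k\<close>.
\<close>

definition node_poly :: "complex poly" where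
  "node_poly = (\<Prod>k\<in>UNIV. [:- z k, 1:])"

lemma degree_node_poly: "degree node_poly = CARD('m)"
  by (simp add: node_poly_def degree_prod_eq_sum_degree)

lemma lead_coeff_node_poly: "coeff node_poly CARD('m) = 1"
proof -
  have "lead_coeff node_poly = 1"
    by (simp add: node_poly_def lead_coeff_prod)
  then show ?thesis by (simp add: degree_node_poly)
qed

lemma poly_node_poly: "poly node_poly (z k) = 0"
  by (auto simp: node_poly_def poly_prod)

lemma mutual_force_node_poly:
  shows "poly (pderiv node_poly) (z k) \<noteq> 0"
    and "z k * poly (pderiv (pderiv node_poly)) (z k)
       = mutual_force z k * poly (pderiv node_poly) (z k)"
proof -
  define R where "R = (\<Prod>j\<in>UNIV - {k}. [:- z j, 1:])"
  have P: "node_poly = [:- z k, 1:] * R"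
    by (simp add: node_poly_def R_def prod.remove[of UNIV k])
  have R0: "poly R (z k) \<noteq> 0"
    by (auto simp: R_def poly_prod node_eq_iff)
  have P': "poly (pderiv node_poly) (z k) = poly R (z k)"
    unfolding P pderiv_linear_mult by simp
  show "poly (pderiv node_poly) (z k) \<noteq> 0"
    using R0 P' by simp
  have "poly (pderiv (pderiv node_poly)) (z k) = 2 * poly (pderiv R) (z k)"
    unfolding P pderiv_linear_mult pderiv_add by simp
  also have "poly (pderiv R) (z k) = poly R (z k) * (\<Sum>j\<in>UNIV - {k}. 1 / (z k - z j))"
    unfolding R_def by (rule poly_pderiv_prod_linear) (auto simp: node_eq_iff)
  finally show "z k * poly (pderiv (pderiv node_poly)) (z k)
       = mutual_force z k * poly (pderiv node_poly) (z k)"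
    unfolding P' mutual_force_def by (simp add: sum_distrib_left sum_distrib_right mult_ac)
qed

text \<open>
  The polynomial \<open>X P'' - (m - 1) P'\<close> for \<open>P = node_poly\<close>. The operator is diagonal on monomials up to a
  shift and annihilates exactly the span of \<open>1\<close> and \<open>X\<^sup>m\<close>.
\<close>

definition euler_poly :: "complex poly" where
  "euler_poly = [:0, 1:] * pderiv (pderiv node_poly)
     - smult (of_nat CARD('m) - 1) (pderiv node_poly)"

lemma coeff_euler_poly:
  "coeff euler_poly n = of_nat (Suc n) * (of_nat (Suc n) - of_nat CARD('m)) * coeff node_poly (Suc n)"
  by (cases n) (simp_all add: euler_poly_def coeff_pderiv algebra_simps)

lemma node_poly_eq:
  assumes a: "\<And>k. z k ^ CARD('m) = a"
  shows "node_poly = monom 1 CARD('m) + [:- a:]"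
proof (rule poly_eqI_degree_lead_coeff[where n = "CARD('m)" and A = "range z"])
  show "CARD('m) \<le> card (range z)"
    using inj by (simp add: card_image)
  show "degree (monom 1 CARD('m) + [:- a:]) \<le> CARD('m)"
    by (rule degree_add_le) (simp_all add: degree_monom_eq)
  show "coeff node_poly CARD('m) = coeff (monom 1 CARD('m) + [:- a:]) CARD('m)"
    by (simp add: lead_coeff_node_poly coeff_pCons split: nat.splits)
qed (auto simp: degree_node_poly poly_node_poly poly_monom a)

lemma mutual_force_constant_iff:
  "(\<forall>k. mutual_force z k = of_nat CARD('m) - 1) \<longleftrightarrow> (\<exists>a. \<forall>k. z k ^ CARD('m) = a)"
proof -
  have card: "card (range z) = CARD('m)"
    using inj by (simp add: card_image)
  have eq: "poly euler_poly (z k)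
      = (mutual_force z k - (of_nat CARD('m) - 1)) * poly (pderiv node_poly) (z k)" for k
    using mutual_force_node_poly(2)[of k] by (simp add: euler_poly_def algebra_simps)
  show ?thesis
  proof
    assume mf: "\<forall>k. mutual_force z k = of_nat CARD('m) - 1"
    have "degree euler_poly < CARD('m)"
    proof (rule degree_lessI)
      show "\<forall>n\<ge>CARD('m). coeff euler_poly n = 0"
        by (simp add: coeff_euler_poly coeff_eq_0 degree_node_poly)
    qed auto
    then have "euler_poly = 0"
      using card mf eq
      by (intro poly_eqI_degree[of "range z"]) auto
    then have c: "coeff node_poly (Suc n) = 0" if "Suc n \<noteq> CARD('m)" for n
      using coeff_euler_poly[of n] that
      by (metis coeff_0 eq_iff_diff_eq_0 mult_eq_0_iff of_nat_0_neq of_nat_eq_iff)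
    have P: "node_poly = monom 1 CARD('m) + [:coeff node_poly 0:]"
    proof (rule poly_eqI)
      fix n
      show "coeff node_poly n = coeff (monom 1 CARD('m) + [:coeff node_poly 0:]) n"
        using c lead_coeff_node_poly by (cases n) auto
    qed
    have "z k ^ CARD('m) = - coeff node_poly 0" for k
    proof -
      have "poly (monom 1 CARD('m) + [:coeff node_poly 0:]) (z k) = 0"
        by (simp only: poly_node_poly flip: P)
      then show ?thesis
        by (simp add: poly_monom add_eq_0_iff2)
    qed
    then show "\<exists>a. \<forall>k. z k ^ CARD('m) = a" by blast
  next
    assume "\<exists>a. \<forall>k. z k ^ CARD('m) = a"
    then obtain a where a: "\<And>k. z k ^ CARD('m) = a" by blast
    then have P: "node_poly = monom 1 CARD('m) + [:- a:]"
      by (rule node_poly_eq)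
    have "coeff euler_poly n = 0" for n
      unfolding coeff_euler_poly by (simp add: P)
    then have "euler_poly = 0"
      by (simp add: poly_eq_iff)
    then show "\<forall>k. mutual_force z k = of_nat CARD('m) - 1"
      using eq mutual_force_node_poly(1) by simp
  qed
qed

text \<open>
  The sum over \<open>k\<close> of \<open>1 / (1 - cnj z\<^sub>j z\<^sub>k) = w / (w - z\<^sub>k)\<close>, with \<open>w = 1 / cnj z\<^sub>j\<close>, is the logarithmic
  derivative \<open>w P'(w) / P(w)\<close> of \<open>P = X\<^sup>m - a\<close>.
\<close>

lemma image_force_polygon:
  assumes a: "\<And>k. z k ^ CARD('m) = a"
  shows "image_force z j = of_real (2 * real CARD('m) * (norm a)\<^sup>2 / (1 - (norm a)\<^sup>2))"
proof -
  let ?m = "of_nat CARD('m) :: complex"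
  define w where "w = 1 / cnj (z j)"
  have wz: "w - z k \<noteq> 0" "w \<noteq> 0" "cnj (z j) * (w - z k) = 1 - cnj (z j) * z k" for k
    using one_minus_gram_neq_0[of k j] nonzero[of j]
    by (auto simp: w_def field_simps)
  have wm: "cnj a * w ^ CARD('m) = 1"
    using a[of j] nonzero[of j] by (auto simp: w_def power_one_over divide_simps)
  have na: "a \<noteq> 0" "norm a < 1"
    using a[of j] nonzero[of j] norm_less_1[of j]
    by (auto simp: norm_power power_less_one_iff)
  have "poly (pderiv node_poly) w = poly node_poly w * (\<Sum>k\<in>UNIV. 1 / (w - z k))"
    unfolding node_poly_def by (rule poly_pderiv_prod_linear) (use wz in auto)
  then have "?m * w ^ (CARD('m) - 1) = (w ^ CARD('m) - a) * (\<Sum>k\<in>UNIV. 1 / (w - z k))"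
    unfolding node_poly_eq[OF a] by (simp add: pderiv_add pderiv_monom pderiv_pCons poly_monom)
  then have "w * (?m * w ^ (CARD('m) - 1)) = (w ^ CARD('m) - a) * (w * (\<Sum>k\<in>UNIV. 1 / (w - z k)))"
    by simp
  moreover have "w * w ^ (CARD('m) - 1) = w ^ CARD('m)"
    by (rule power_minus_mult[of "CARD('m)" w, unfolded mult.commute[of _ w]]) simp
  ultimately have "(w ^ CARD('m) - a) * (\<Sum>k\<in>UNIV. w / (w - z k)) = ?m * w ^ CARD('m)"
    by (simp add: sum_distrib_left mult.left_commute[of w])
  then have "(cnj a * w ^ CARD('m) - a * cnj a) * (\<Sum>k\<in>UNIV. w / (w - z k))
      = ?m * (cnj a * w ^ CARD('m))"
  proof -
    assume *: "(w ^ CARD('m) - a) * (\<Sum>k\<in>UNIV. w / (w - z k)) = ?m * w ^ CARD('m)"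
    have "(cnj a * w ^ CARD('m) - a * cnj a) * (\<Sum>k\<in>UNIV. w / (w - z k))
        = cnj a * ((w ^ CARD('m) - a) * (\<Sum>k\<in>UNIV. w / (w - z k)))"
      by (simp add: left_diff_distrib right_diff_distrib mult_ac)
    also have "\<dots> = ?m * (cnj a * w ^ CARD('m))"
      unfolding * by (rule mult.left_commute)
    finally show ?thesis .
  qed
  then have 1: "(1 - a * cnj a) * (\<Sum>k\<in>UNIV. w / (w - z k)) = ?m"
    unfolding wm by simp
  have "w / (w - z k) = 1 / cnj (1 - z j * cnj (z k))" for k
    using wz(1)[of k] nonzero[of j] unfolding complex_cnj_diff complex_cnj_mult complex_cnj_cnj complex_cnj_one wz(3)[symmetric]
    by (simp add: w_def)
  then have "(\<Sum>k\<in>UNIV. w / (w - z k)) = cnj (\<Sum>k\<in>UNIV. 1 / (1 - z j * cnj (z k)))"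
    by simp
  with 1 have "cnj ((1 - cnj a * a) * (\<Sum>k\<in>UNIV. 1 / (1 - z j * cnj (z k)))) = cnj ?m"
    by (simp add: mult.commute)
  then have 2: "(1 - of_real ((norm a)\<^sup>2)) * (\<Sum>k\<in>UNIV. 1 / (1 - z j * cnj (z k))) = ?m"
    unfolding complex_cnj_cancel_iff complex_norm_square by (simp only: mult.commute)
  have "(norm a)\<^sup>2 < 1"
    using na by (simp add: abs_square_less_1)
  then have 3: "1 - complex_of_real ((norm a)\<^sup>2) \<noteq> 0"
    by (metis eq_iff_diff_eq_0 less_irrefl of_real_1 of_real_eq_iff)
  have "image_force z j = 2 * (?m / (1 - of_real ((norm a)\<^sup>2))) - 2 * ?m"
    unfolding image_force_eq 2[symmetric] using 3 by simp
  also have "\<dots> = 2 * ?m * of_real ((norm a)\<^sup>2) / (1 - of_real ((norm a)\<^sup>2))"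
    using 3 by (simp add: field_simps)
  finally show ?thesis
    by simp
qed
end

context disk_configuration
begin

lemma force_balance_iff_polygon:
  "force_balance \<alpha> z \<longleftrightarrow> (\<exists>a. (\<forall>k. z k ^ CARD('m) = a) \<and>
     2 * real CARD('m) * (norm a)\<^sup>2 / (1 - (norm a)\<^sup>2) = \<alpha> + 1 - real CARD('m))"
proof -
  have bal: "image_force z j + mutual_force z j = of_real \<alpha> \<longleftrightarrow>
      2 * real CARD('m) * (norm a)\<^sup>2 / (1 - (norm a)\<^sup>2) = \<alpha> + 1 - real CARD('m)"
    if a: "\<forall>k. z k ^ CARD('m) = a" for a j
  proof -
    have "mutual_force z j = of_real (real CARD('m) - 1)"
      using mutual_force_constant_iff a by auto
    moreover have "image_force z j = of_real (2 * real CARD('m) * (norm a)\<^sup>2 / (1 - (norm a)\<^sup>2))"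
      using a by (intro image_force_polygon) simp
    ultimately have "image_force z j + mutual_force z j = of_real \<alpha> \<longleftrightarrow>
        2 * real CARD('m) * (norm a)\<^sup>2 / (1 - (norm a)\<^sup>2) + (real CARD('m) - 1) = \<alpha>"
      by (simp only: of_real_eq_iff flip: of_real_add)
    then show ?thesis by linarith
  qed
  show ?thesis
  proof
    assume fb: "force_balance \<alpha> z"
    then obtain a where a: "\<forall>k. z k ^ CARD('m) = a"
      using mutual_force_constant mutual_force_constant_iff by blast
    with fb bal[OF a] show "\<exists>a. (\<forall>k. z k ^ CARD('m) = a) \<and>
       2 * real CARD('m) * (norm a)\<^sup>2 / (1 - (norm a)\<^sup>2) = \<alpha> + 1 - real CARD('m)"
      unfolding force_balance_def by blast
  qed (use bal in \<open>auto simp: force_balance_def\<close>)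
qed

end

text \<open>
  The \<open>m\<close>-th roots of a nonzero \<open>a\<close> form a regular \<open>m\<close>-gon, and \<open>m\<close> distinct roots exhaust
  them.
\<close>

lemma regular_polygon_vertices_iff:
  fixes z :: "complex ^ 'm::finite"
  assumes inj: "inj (($) z)" and nonzero: "\<And>k. z $ k \<noteq> 0"
  shows "regular_polygon_vertices z \<longleftrightarrow> (\<exists>a. \<forall>k. z $ k ^ CARD('m) = a)"
proof
  let ?m = "CARD('m)"
  assume "regular_polygon_vertices z"
  then obtain r \<theta> \<sigma> where \<sigma>: "bij_betw \<sigma> {1..?m} UNIV" and
    z: "\<And>j. j \<in> {1..?m} \<Longrightarrow> z $ \<sigma> j = of_real r * cis (\<theta> + 2 * pi * (real j - 1) / real ?m)"
    unfolding regular_polygon_vertices_def by blast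
  have "z $ k ^ ?m = (of_real r * cis \<theta>) ^ ?m" for k
  proof -
    obtain j where j: "j \<in> {1..?m}" "k = \<sigma> j"
      using \<sigma> by (metis UNIV_I bij_betw_imp_surj_on imageE)
    have "real ?m * (\<theta> + 2 * pi * (real j - 1) / real ?m) = real ?m * \<theta> + 2 * pi * of_int (int j - 1)"
      by (simp add: field_simps)
    then have "cis (\<theta> + 2 * pi * (real j - 1) / real ?m) ^ ?m = cis (real ?m * \<theta>) * cis (2 * pi * of_int (int j - 1))"
      by (simp only: Complex.DeMoivre cis_mult)
    also have "cis (2 * pi * of_int (int j - 1)) = 1"
      by (rule cis_multiple_2pi) (rule Ints_of_int)
    finally show ?thesis
      unfolding j(2) z[OF j(1)] by (simp add: power_mult_distrib Complex.DeMoivre)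
  qed
  then show "\<exists>a. \<forall>k. z $ k ^ ?m = a" by blast
next
  let ?m = "CARD('m)"
  assume "\<exists>a. \<forall>k. z $ k ^ ?m = a"
  then obtain a where a: "\<And>k. z $ k ^ ?m = a" by blast
  then have a0: "a \<noteq> 0" using nonzero by (metis power_not_zero)
  define r where "r = root ?m (norm a)"
  define \<theta> where "\<theta> = Arg a / real ?m"
  define v where "v j = of_real r * cis (\<theta> + 2 * pi * (real j - 1) / real ?m)" for j :: nat
  \<comment> \<open>\<open>v\<close> enumerates the roots of \<open>a\<close>: a shift of the index, followed by the roots of unity,
    followed by multiplication with one root of \<open>a\<close>.\<close>
  have 1: "bij_betw (\<lambda>j. j - 1) {1..?m} {..<?m}"
    by (rule bij_betw_byWitness[where f' = Suc]) auto
  have 2: "bij_betw (\<lambda>j. cis (2 * pi * real j / real ?m)) {..<?m} {x. x ^ ?m = 1}"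
    by (rule Complex.bij_betw_roots_unity) simp
  have 3: "bij_betw (\<lambda>x. of_real r * cis \<theta> * x) {x. x ^ ?m = 1} {x. x ^ ?m = a}"
    unfolding r_def \<theta>_def using bij_betw_nth_root_unity[OF a0, of ?m] by simp
  have "bij_betw v {1..?m} {x. x ^ ?m = a}"
  proof (rule bij_betw_cong[THEN iffD1, OF _ bij_betw_trans[OF 1 bij_betw_trans[OF 2 3]]])
    show "((\<lambda>x. of_real r * cis \<theta> * x) \<circ> (\<lambda>j. cis (2 * pi * real j / real ?m)) \<circ> (\<lambda>j. j - 1)) j = v j"
      if "j \<in> {1..?m}" for j
      using that by (simp add: v_def of_nat_diff mult.assoc cis_mult)
  qed
  moreover have "range (($) z) = {x. x ^ ?m = a}"
  proof (rule card_subset_eq)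
    show "finite {x. x ^ ?m = a}"
      by (rule finite_nth_roots) simp
    show "range (($) z) \<subseteq> {x. x ^ ?m = a}"
      using a by auto
    show "card (range (($) z)) = card {x. x ^ ?m = a}"
      using inj a0 by (simp add: card_image card_nth_roots)
  qed
  then have "bij_betw (inv (($) z)) {x. x ^ ?m = a} UNIV"
    using inj by (metis bij_betw_inv_into inj_on_imp_bij_betw)
  ultimately have \<sigma>: "bij_betw (inv (($) z) \<circ> v) {1..?m} UNIV"
    by (rule bij_betw_trans)
  have "z $ (inv (($) z) \<circ> v) j = v j" if "j \<in> {1..?m}" for j
    using \<open>bij_betw v _ _\<close> \<open>range (($) z) = _\<close> that
    by (metis bij_betwE comp_apply f_inv_into_f)
  moreover have "r > 0" using a0 by (simp add: r_def)
  ultimately show "regular_polygon_vertices z"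
    unfolding regular_polygon_vertices_def v_def[symmetric]
    by (intro exI[of _ r] exI[of _ \<theta>] exI[of _ "inv (($) z) \<circ> v"] conjI ballI \<sigma>)
       (simp_all only: v_def)
qed

section \<open>The derivative of the energy\<close>

lemma has_derivative_ln_norm:
  fixes f :: "'a::real_normed_vector \<Rightarrow> complex"
  assumes f: "(f has_derivative f') (at x)" and nz: "f x \<noteq> 0"
  shows "((\<lambda>x. ln (norm (f x))) has_derivative (\<lambda>h. Re (f' h / f x))) (at x)"
proof -
  have "((\<lambda>x. norm (f x)) has_derivative (\<lambda>h. inner (f' h) (sgn (f x)))) (at x)"
    using has_derivative_compose[OF f has_derivative_norm[OF nz]] .
  then have "((\<lambda>x. ln (norm (f x))) has_derivative
      (\<lambda>h. inner (f' h) (sgn (f x)) * (1 / norm (f x)))) (at x)"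
    by (rule DERIV_compose_FDERIV[where f = ln, rotated], intro DERIV_ln_divide) (simp add: nz)
  moreover have "inner (f' h) (sgn (f x)) * (1 / norm (f x)) = Re (f' h / f x)" for h
  proof -
    have "inner (f' h) (sgn (f x)) * (1 / norm (f x))
        = (Re (f' h) * Re (f x) + Im (f' h) * Im (f x)) / (norm (f x))\<^sup>2"
      by (simp add: sgn_div_norm inner_complex_def power2_eq_square divide_inverse algebra_simps)
    then show ?thesis
      by (simp add: Re_divide cmod_power2)
  qed
  ultimately show ?thesis by simp
qed

text \<open>
  The terms \<open>ln (1 - \<bar>z\<^sub>j\<bar>\<^sup>2)\<close> are the diagonal of the double sum over \<open>ln \<bar>1 - z\<^sub>j cnj z\<^sub>k\<bar>\<close>. The identity
  holds for all \<open>z\<close>, since the real logarithm is extended by \<open>ln (- x) = ln x\<close>.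
\<close>

lemma Phi_altdef:
  fixes z :: "complex ^ 'm::finite"
  shows "Phi \<alpha> z = 2 * \<alpha> * (\<Sum>j\<in>UNIV. ln (norm (z $ j)))
     + 2 * (\<Sum>j\<in>UNIV. \<Sum>k\<in>UNIV. ln (norm (1 - z $ j * cnj (z $ k))))
     - 2 * (\<Sum>j\<in>UNIV. \<Sum>k\<in>UNIV - {j}. ln (norm (z $ j - z $ k)))"
proof -
  have pairs: "(\<Sum>(j, k) \<in> {(j, k). j \<noteq> k}. f j k) = (\<Sum>j\<in>UNIV. \<Sum>k\<in>UNIV - {j}. f j k)"
    for f :: "'m \<Rightarrow> 'm \<Rightarrow> real"
  proof -
    have "{(j, k). j \<noteq> k} = (SIGMA j:UNIV. UNIV - {j::'m})" by auto
    then show ?thesis by (simp add: sum.Sigma)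
  qed
  have "ln (1 - (norm w)\<^sup>2) = ln (norm (1 - w * cnj w))" for w :: complex
  proof -
    have "norm (1 - w * cnj w) = \<bar>1 - (norm w)\<^sup>2\<bar>"
      by (metis complex_norm_square norm_of_real of_real_1 of_real_diff)
    moreover have "ln \<bar>y\<bar> = ln y" for y :: real
      by (simp add: abs_if ln_minus)
    ultimately show ?thesis by simp
  qed
  moreover have "(\<Sum>k\<in>UNIV. ln (norm (1 - z $ j * cnj (z $ k))))
      = ln (norm (1 - z $ j * cnj (z $ j))) + (\<Sum>k\<in>UNIV - {j}. ln (norm (1 - z $ j * cnj (z $ k))))"
    for j
    by (rule sum.remove) auto
  ultimately show ?thesis
    unfolding Phi_def pairs by (simp add: sum.distrib algebra_simps)
qed

text \<open>
  The coefficient of \<open>h\<^sub>j\<close> in the derivative of \<open>\<Phi>\<close>, that is, twice the Wirtinger derivative of \<open>\<Phi>\<close> with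
  respect to \<open>z\<^sub>j\<close>.
\<close>

definition Phi_gradient :: "real \<Rightarrow> complex ^ 'm \<Rightarrow> 'm::finite \<Rightarrow> complex" where
  "Phi_gradient \<alpha> z j = 2 / z $ j * (of_real \<alpha> - (image_force (($) z) j + mutual_force (($) z) j))"

lemma Phi_has_derivative:
  fixes z :: "complex ^ 'm::finite"
  assumes "disk_configuration (($) z)"
  shows "(Phi \<alpha> has_derivative (\<lambda>h. \<Sum>j\<in>UNIV. Re (Phi_gradient \<alpha> z j * h $ j))) (at z)"
proof -
  interpret disk_configuration "($) z" by fact
  let ?A = "\<lambda>h. \<Sum>j\<in>UNIV. Re (h $ j / z $ j)"
  let ?B = "\<lambda>h. \<Sum>j\<in>UNIV. \<Sum>k\<in>UNIV.
      Re (- (h $ j * cnj (z $ k) + z $ j * cnj (h $ k)) / (1 - z $ j * cnj (z $ k)))"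
  let ?C = "\<lambda>h. \<Sum>j\<in>UNIV. \<Sum>k\<in>UNIV - {j}. Re ((h $ j - h $ k) / (z $ j - z $ k))"
  have nth: "((\<lambda>z. z $ j) has_derivative (\<lambda>h. h $ j)) (at z)" for j
    by (intro bounded_linear_imp_has_derivative bounded_linear_vec_nth)
  have cnj_nth: "((\<lambda>z. cnj (z $ j)) has_derivative (\<lambda>h. cnj (h $ j))) (at z)" for j
    by (intro has_derivative_cnj nth)
  have A: "((\<lambda>z. \<Sum>j\<in>UNIV. ln (norm (z $ j))) has_derivative ?A) (at z)"
    by (intro has_derivative_sum has_derivative_ln_norm nth nonzero)
  have B: "((\<lambda>z. \<Sum>j\<in>UNIV. \<Sum>k\<in>UNIV. ln (norm (1 - z $ j * cnj (z $ k)))) has_derivative ?B) (at z)"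
  proof (intro has_derivative_sum has_derivative_ln_norm one_minus_gram_neq_0)
    fix j k
    show "((\<lambda>z. 1 - z $ j * cnj (z $ k)) has_derivative
        (\<lambda>h. - (h $ j * cnj (z $ k) + z $ j * cnj (h $ k)))) (at z)"
      using has_derivative_diff[OF has_derivative_const[of 1] has_derivative_mult[OF nth[of j] cnj_nth[of k]]]
      by (simp add: add.commute)
  qed
  have C: "((\<lambda>z. \<Sum>j\<in>UNIV. \<Sum>k\<in>UNIV - {j}. ln (norm (z $ j - z $ k))) has_derivative ?C) (at z)"
    by (intro has_derivative_sum has_derivative_ln_norm has_derivative_diff nth)
       (auto simp: node_eq_iff)
  have D: "(Phi \<alpha> has_derivative (\<lambda>h. 2 * \<alpha> * ?A h + 2 * ?B h - 2 * ?C h)) (at z)"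
    unfolding Phi_altdef[abs_def]
    by (intro has_derivative_add has_derivative_diff has_derivative_mult_right A B C)
  have "2 * \<alpha> * ?A h + 2 * ?B h - 2 * ?C h = (\<Sum>j\<in>UNIV. Re (Phi_gradient \<alpha> z j * h $ j))" for h
  proof -
    have Ah: "2 * \<alpha> * ?A h = (\<Sum>j\<in>UNIV. Re (2 * of_real \<alpha> / z $ j * h $ j))"
      unfolding sum_distrib_left
      by (intro sum.cong refl) (simp add: Re_divide Im_divide field_simps)
    have re4: "Re (4 * x) = 4 * Re x" for x
      by simp
    define b where "b j k = Re (h $ j * cnj (z $ k) / (1 - z $ j * cnj (z $ k)))" for j k
    have b': "Re (z $ j * cnj (h $ k) / (1 - z $ j * cnj (z $ k))) = b k j" for j k
    proof -
      have "cnj (z $ j * cnj (h $ k) / (1 - z $ j * cnj (z $ k)))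
          = h $ k * cnj (z $ j) / (1 - z $ k * cnj (z $ j))"
        by (simp add: mult.commute)
      then show ?thesis unfolding b_def by (metis cnj.sel(1))
    qed
    have "?B h = (\<Sum>j\<in>UNIV. \<Sum>k\<in>UNIV. - (b j k + b k j))"
    proof (intro sum.cong refl)
      fix j k
      show "Re (- (h $ j * cnj (z $ k) + z $ j * cnj (h $ k)) / (1 - z $ j * cnj (z $ k)))
          = - (b j k + b k j)"
        unfolding b'[of j k, symmetric] b_def[of j k]
        by (simp add: add_divide_distrib diff_divide_distrib)
    qed
    also have "\<dots> = - ((\<Sum>j\<in>UNIV. \<Sum>k\<in>UNIV. b j k) + (\<Sum>j\<in>UNIV. \<Sum>k\<in>UNIV. b k j))"
      by (simp add: sum_negf sum_subtractf sum.distrib)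
    also have "(\<Sum>j\<in>UNIV. \<Sum>k\<in>UNIV. b k j) = (\<Sum>j\<in>UNIV. \<Sum>k\<in>UNIV. b j k)"
      by (rule sum.swap)
    \<comment> \<open>Each unordered pair contributes twice, by symmetry under \<open>j \<leftrightarrow> k\<close>.\<close>
    finally have "2 * ?B h = - (\<Sum>j\<in>UNIV. \<Sum>k\<in>UNIV. 4 * b j k)"
      by (simp flip: sum_distrib_left)
    also have "(\<Sum>j\<in>UNIV. \<Sum>k\<in>UNIV. 4 * b j k)
        = (\<Sum>j\<in>UNIV. Re (2 * image_force (($) z) j / z $ j * h $ j))"
    proof (rule sum.cong[OF refl])
      fix j
      have "2 * image_force (($) z) j / z $ j * h $ j
          = (\<Sum>k\<in>UNIV. of_real 4 * (h $ j * cnj (z $ k) / (1 - z $ j * cnj (z $ k))))"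
        unfolding image_force_def sum_distrib_left sum_distrib_right sum_divide_distrib
        using nonzero[of j] by (intro sum.cong refl) (simp add: mult_ac)
      then show "(\<Sum>k\<in>UNIV. 4 * b j k) = Re (2 * image_force (($) z) j / z $ j * h $ j)"
        by (simp only: Re_sum b_def re4 of_real_numeral)
    qed
    finally have Bh: "2 * ?B h = - (\<Sum>j\<in>UNIV. Re (2 * image_force (($) z) j / z $ j * h $ j))" .
    define c where "c j k = Re (h $ j / (z $ j - z $ k))" for j k
    have c': "Re (h $ k / (z $ j - z $ k)) = - c k j" for j k
      unfolding c_def by (metis minus_diff_eq minus_divide_right uminus_complex.sel(1))
    have "?C h = (\<Sum>j\<in>UNIV. \<Sum>k\<in>UNIV. c j k + c k j)"
    proof (rule sum.cong[OF refl])
      fix j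
      have "(\<Sum>k\<in>UNIV - {j}. Re ((h $ j - h $ k) / (z $ j - z $ k))) = (\<Sum>k\<in>UNIV - {j}. c j k + c k j)"
        by (intro sum.cong refl) (simp add: diff_divide_distrib c' flip: c_def)
      also have "\<dots> = (\<Sum>k\<in>UNIV. c j k + c k j)"
        by (rule sum.mono_neutral_left) (auto simp: c_def)
      finally show "(\<Sum>k\<in>UNIV - {j}. Re ((h $ j - h $ k) / (z $ j - z $ k))) = \<dots>" .
    qed
    also have "\<dots> = (\<Sum>j\<in>UNIV. \<Sum>k\<in>UNIV. c j k) + (\<Sum>j\<in>UNIV. \<Sum>k\<in>UNIV. c k j)"
      by (simp add: sum.distrib)
    also have "(\<Sum>j\<in>UNIV. \<Sum>k\<in>UNIV. c k j) = (\<Sum>j\<in>UNIV. \<Sum>k\<in>UNIV. c j k)"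
      by (rule sum.swap)
    finally have "2 * ?C h = (\<Sum>j\<in>UNIV. \<Sum>k\<in>UNIV. 4 * c j k)"
      by (simp flip: sum_distrib_left)
    also have "\<dots> = (\<Sum>j\<in>UNIV. Re (2 * mutual_force (($) z) j / z $ j * h $ j))"
    proof (rule sum.cong[OF refl])
      fix j
      have "2 * mutual_force (($) z) j / z $ j * h $ j
          = (\<Sum>k\<in>UNIV. of_real 4 * (h $ j / (z $ j - z $ k)))"
        unfolding mutual_force_eq_sum_UNIV sum_distrib_left sum_distrib_right sum_divide_distrib
        using nonzero[of j] by (intro sum.cong refl) (simp add: mult_ac)
      then show "(\<Sum>k\<in>UNIV. 4 * c j k) = Re (2 * mutual_force (($) z) j / z $ j * h $ j)"
        by (simp only: Re_sum c_def re4 of_real_numeral)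
    qed
    finally have Ch: "2 * ?C h = (\<Sum>j\<in>UNIV. Re (2 * mutual_force (($) z) j / z $ j * h $ j))" .
    show ?thesis
      unfolding Ah Bh Ch Phi_gradient_def
      by (simp add: algebra_simps diff_divide_distrib sum_subtractf sum.distrib)
  qed
  with D show ?thesis by simp
qed

lemma sum_Re_mult_eq_0_iff:
  fixes a :: "'m::finite \<Rightarrow> complex"
  shows "(\<forall>h :: complex ^ 'm. (\<Sum>j\<in>UNIV. Re (a j * h $ j)) = 0) \<longleftrightarrow> (\<forall>j. a j = 0)"
proof
  assume "\<forall>h :: complex ^ 'm. (\<Sum>j\<in>UNIV. Re (a j * h $ j)) = 0"
  then have "(\<Sum>j\<in>UNIV. Re (a j * (\<chi> j. cnj (a j)) $ j)) = 0" by blast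
  then have "(\<Sum>j\<in>UNIV. (norm (a j))\<^sup>2) = 0"
    by (simp add: cmod_power2 flip: power2_eq_square)
  then show "\<forall>j. a j = 0"
    by (simp add: sum_nonneg_eq_0_iff)
qed simp

lemma disk_configuration_iff:
  fixes z :: "complex ^ 'm::finite"
  shows "z \<in> punctured_polydisk - Theta \<longleftrightarrow> disk_configuration (($) z)"
  unfolding punctured_polydisk_def Theta_def punctured_disk_def disk_configuration_def inj_def
  by auto

theorem critical_point_iff_force_balance:
  fixes z :: "complex ^ 'm::finite"
  shows "critical_point (Phi \<alpha>) (punctured_polydisk - Theta) z
     \<longleftrightarrow> z \<in> punctured_polydisk - Theta \<and> force_balance \<alpha> (($) z)"
proof (cases "z \<in> punctured_polydisk - Theta")
  case True
  then have z: "disk_configuration (($) z)" by (simp only: disk_configuration_iff)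
  let ?D = "\<lambda>h. \<Sum>j\<in>UNIV. Re (Phi_gradient \<alpha> z j * h $ j)"
  have D: "(Phi \<alpha> has_derivative ?D) (at z)"
    using z by (rule Phi_has_derivative)
  have grad: "Phi_gradient \<alpha> z j = 0 \<longleftrightarrow> image_force (($) z) j + mutual_force (($) z) j = of_real \<alpha>" for j
    using disk_configuration.nonzero[OF z, of j]
    by (simp only: Phi_gradient_def mult_eq_0_iff divide_eq_0_iff) auto
  have "(Phi \<alpha> has_derivative (\<lambda>h. 0)) (at z) \<longleftrightarrow> ?D = (\<lambda>h. 0)"
  proof
    assume "(Phi \<alpha> has_derivative (\<lambda>h. 0)) (at z)"
    with D show "?D = (\<lambda>h. 0)" by (rule has_derivative_unique)
  next
    assume "?D = (\<lambda>h. 0)"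
    with D show "(Phi \<alpha> has_derivative (\<lambda>h. 0)) (at z)" by (simp only:)
  qed
  also have "\<dots> \<longleftrightarrow> (\<forall>j. Phi_gradient \<alpha> z j = 0)"
    unfolding sum_Re_mult_eq_0_iff[symmetric] fun_eq_iff ..
  also have "\<dots> \<longleftrightarrow> force_balance \<alpha> (($) z)"
    unfolding force_balance_def grad ..
  finally show ?thesis
    using True by (simp add: critical_point_def)
qed (auto simp: critical_point_def)

section \<open>Classification of the critical points\<close>

lemma critical_radius_power:
  assumes "m > 0" "real m < 1 + \<alpha>"
  shows "critical_radius \<alpha> m ^ (2 * m) = (\<alpha> + 1 - real m) / (\<alpha> + 1 + real m)"
proof -
  have "(\<alpha> + 1 - real m) / (\<alpha> + 1 + real m) > 0"
    using assms by (intro divide_pos_pos) auto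
  then show ?thesis
    using assms unfolding critical_radius_def
    by (simp add: powr_powr flip: powr_realpow)
qed

theorem theorem1p1:
  fixes \<alpha> :: real
  assumes "\<alpha> > 0"
  shows "(real CARD('m::finite) < 1 + \<alpha> \<longrightarrow>
           (\<forall>z :: complex ^ 'm. z \<in> punctured_polydisk - Theta \<longrightarrow>
              (critical_point (Phi \<alpha>) (punctured_polydisk - Theta) z \<longleftrightarrow>
               regular_polygon_vertices z \<and>
               (\<forall>j. norm (z $ j) = critical_radius \<alpha> CARD('m)))))
       \<and> (real CARD('n::finite) \<ge> 1 + \<alpha> \<longrightarrow>
           \<not> (\<exists>z :: complex ^ 'n. critical_point (Phi \<alpha>) (punctured_polydisk - Theta) z))"
proof (intro conjI impI allI)
  let ?m = "CARD('m)"
  fix z :: "complex ^ 'm"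
  assume m: "real ?m < 1 + \<alpha>" and z: "z \<in> punctured_polydisk - Theta"
  interpret disk_configuration "($) z"
    using z by (simp only: disk_configuration_iff)
  have radius: "2 * real ?m * (norm a)\<^sup>2 / (1 - (norm a)\<^sup>2) = \<alpha> + 1 - real ?m
      \<longleftrightarrow> (\<forall>j. norm (z $ j) = critical_radius \<alpha> ?m)"
    if a: "\<forall>k. z $ k ^ ?m = a" for a
  proof -
    have R: "norm (z $ j) ^ (2 * ?m) = (norm a)\<^sup>2" for j
      using a[rule_format, of j] by (metis norm_power power_mult mult.commute)
    have "norm (z $ j) ^ (2 * ?m) < 1" for j
      using norm_less_1[of j] by (simp add: power_less_one_iff)
    then have lt1: "(norm a)\<^sup>2 < 1" unfolding R by simp
    have "2 * real ?m * (norm a)\<^sup>2 / (1 - (norm a)\<^sup>2) = \<alpha> + 1 - real ?m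
        \<longleftrightarrow> (norm a)\<^sup>2 = (\<alpha> + 1 - real ?m) / (\<alpha> + 1 + real ?m)"
      using lt1 \<open>\<alpha> > 0\<close> by (simp add: divide_eq_eq eq_divide_eq) (auto simp: algebra_simps)
    also have "\<dots> \<longleftrightarrow> (\<forall>j. norm (z $ j) ^ (2 * ?m) = critical_radius \<alpha> ?m ^ (2 * ?m))"
      using m by (simp add: R critical_radius_power)
    also have "\<dots> \<longleftrightarrow> (\<forall>j. norm (z $ j) = critical_radius \<alpha> ?m)"
      by (intro all_cong1 power_eq_iff_eq_base) (auto simp: critical_radius_def)
    finally show ?thesis .
  qed
  have "critical_point (Phi \<alpha>) (punctured_polydisk - Theta) z \<longleftrightarrow> force_balance \<alpha> (($) z)"
    using critical_point_iff_force_balance z by blast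
  also have "\<dots> \<longleftrightarrow> (\<exists>a. \<forall>k. z $ k ^ ?m = a) \<and> (\<forall>j. norm (z $ j) = critical_radius \<alpha> ?m)"
    unfolding force_balance_iff_polygon using radius by blast
  also have "(\<exists>a. \<forall>k. z $ k ^ ?m = a) \<longleftrightarrow> regular_polygon_vertices z"
    using regular_polygon_vertices_iff[OF inj nonzero] by simp
  finally show "critical_point (Phi \<alpha>) (punctured_polydisk - Theta) z \<longleftrightarrow>
      regular_polygon_vertices z \<and> (\<forall>j. norm (z $ j) = critical_radius \<alpha> ?m)" .
next
  assume n: "1 + \<alpha> \<le> real CARD('n)"
  show "\<not> (\<exists>z :: complex ^ 'n. critical_point (Phi \<alpha>) (punctured_polydisk - Theta) z)"
  proof
    assume "\<exists>z :: complex ^ 'n. critical_point (Phi \<alpha>) (punctured_polydisk - Theta) z"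
    then obtain z :: "complex ^ 'n" where z: "z \<in> punctured_polydisk - Theta"
        and fb: "force_balance \<alpha> (($) z)"
      unfolding critical_point_iff_force_balance by blast
    interpret disk_configuration "($) z"
      using z by (simp only: disk_configuration_iff)
    obtain a where a: "\<And>k. z $ k ^ CARD('n) = a" and
      eq: "2 * real CARD('n) * (norm a)\<^sup>2 / (1 - (norm a)\<^sup>2) = \<alpha> + 1 - real CARD('n)"
      using fb unfolding force_balance_iff_polygon by blast
    fix j :: 'n
    have "norm a = norm (z $ j) ^ CARD('n)"
      by (simp only: norm_power flip: a[of j])
    then have "0 < norm a" "norm a < 1"
      using nonzero[of j] norm_less_1[of j] by (simp_all add: power_less_one_iff)
    then have "2 * real CARD('n) * (norm a)\<^sup>2 / (1 - (norm a)\<^sup>2) > 0"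
      by (intro divide_pos_pos mult_pos_pos) (simp_all add: abs_square_less_1)
    with eq n show False by simp
  qed
qed

end
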